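(* Let $n\ge 3$, let $e=e(\sigma_x,\sigma_y,\sigma_z)$ be a top-dimensional cell of $P_n$ with $\sigma_x,\sigma_y,\sigma_z\in\Sigma_{n-1}$, and let $\tau_x=(a\ b)$ be a transposition appearing in $\sigma_x$. Then there is a straight-line geometric isotopy between the representative knots for $e$ and $\tau_x\cdot e=e(\tau_x\sigma_x,\sigma_y,\sigma_z)$ if and only if $\tau_x$ does not produce a $y$-$z$ intersection for $e$.
   Context: Plumbers' curves. Let $v=(v_1,\dots,v_{n-1})\in((0,1)^3)^{n-1}$. Write $v_i=(v_i^x,v_i^y,v_i^z)$, and by convention $v_0=(0,0,0)$, $v_n=(1,1,1)$. For $0\le i\le n-1$ define three (possibly degenerate) straight segments, called pipes: $\mathbf x_i$ from $(v_i^x,v_i^y,v_i^z)$ to $(v_{i+1}^x,v_i^y,v_i^z)$; $\mathbf y_i$ from $(v_{i+1}^x,v_i^y,v_i^z)$ to $(v_{i+1}^x,v_{i+1}^y,v_i^z)$; $\mathbf z_i$ from $(v_{i+1}^x,v_{i+1}^y,v_i^z)$ to $(v_{i+1}^x,v_{i+1}^y,v_{i+1}^z)$. The $n$-move plumbers' curve $\phi_v$ is the piecewise linear path traversing the pipes linearly in the order $\mathbf x_0,\mathbf y_0,\mathbf z_0,\mathbf x_1,\dots,\mathbf z_{n-1}$. The space $P_n$ of all $\phi_v$ is identified (and topologized) with $((0,1)^3)^{n-1}$ via $v$. Two pipes are distant if, in this ordered sequence, they are separated by at least three intervening pipes. The curve $\phi_v$ is singular if the images of some pair of its distant pipes intersect;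 otherwise it is a plumbers' knot. $K_n\subseteq P_n$ is the subspace of plumbers' knots. A geometric isotopy between $\phi_v,\phi_w\in K_n$ is a continuous path in $K_n$ from $\phi_v$ to $\phi_w$; it is a straight-line geometric isotopy if it is the path $t\mapsto\phi_{(1-t)v+tw}$, $t\in[0,1]$ (all of whose points must therefore lie in $K_n$). Cells. For $\sigma_x,\sigma_y,\sigma_z\in\Sigma_{n-1}$ (symmetric group), $e(\sigma_x,\sigma_y,\sigma_z)\subset P_n$ is the set of $\phi_v$ with $0<v^c_{\sigma_c(1)}<\cdots<v^c_{\sigma_c(n-1)}<1$ for each $c\in\{x,y,z\}$; these are the top-dimensional cells. The representative knot of $e=e(\sigma_x,\sigma_y,\sigma_z)$ is $\phi_{v(e)}$ with $v(e)_i=\left(\frac{\sigma_x^{-1}(i)}n,\frac{\sigma_y^{-1}(i)}n,\frac{\sigma_z^{-1}(i)}n\right)$ for $1\le i\le n-1$. A transposition $\tau$ appears in $\sigma\in\Sigma_{n-1}$ if $\tau=(\sigma(i)\ \sigma(i+1))$ for some $i\in\{1,\dots,n-2\}$. Products of permutations are compositions: $(\tau\sigma)(i)=\tau(\sigma(i))$. Producing an intersection. By convention set $\sigma^{-1}(0)=0$ and $\sigma^{-1}(n)=n$ for $\sigma\in\Sigma_{n-1}$; "between" means strictly between (in either order). A transposition $\tau_x=(a\ b)$ appearing in $\sigma_x$ produces a ($y$-$z$) intersection for $e(\sigma_x,\sigma_y,\sigma_z)$ if one of the following holds: (1) $\sigma_y^{-1}(b)$ is between $\sigma_y^{-1}(a-1)$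 and $\sigma_y^{-1}(a)$, and $\sigma_z^{-1}(a-1)$ is between $\sigma_z^{-1}(b-1)$ and $\sigma_z^{-1}(b)$; or (2) $\sigma_y^{-1}(a)$ is between $\sigma_y^{-1}(b-1)$ and $\sigma_y^{-1}(b)$, and $\sigma_z^{-1}(b-1)$ is between $\sigma_z^{-1}(a-1)$ and $\sigma_z^{-1}(a)$. *)

theory Defs
  imports "HOL-Analysis.Analysis"
begin

section \<open>Plumbers' curves\<close>

text \<open>
  A parameter \<open>v\<close> is an extensional function on the index set \<open>{1..n-1}\<close> with values in the open
  unit cube; \<open>0\<close> and \<open>1\<close> in \<open>real^3\<close> are the points \<open>(0,0,0)\<close> and \<open>(1,1,1)\<close>.
\<close>

definition parameters :: "nat \<Rightarrow> (nat \<Rightarrow> real^3) set" where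
  "parameters n = (\<Pi>\<^sub>E i\<in>{1..n-1}. box 0 1)"

definition parameter_topology :: "nat \<Rightarrow> (nat \<Rightarrow> real^3) topology" where
  "parameter_topology n = product_topology (\<lambda>i. top_of_set (box 0 1)) {1..n-1}"

definition vertex :: "nat \<Rightarrow> (nat \<Rightarrow> real^3) \<Rightarrow> nat \<Rightarrow> real^3" where
  "vertex n v i = (if i = 0 then 0 else if i = n then 1 else v i)"

definition x_pipe :: "nat \<Rightarrow> (nat \<Rightarrow> real^3) \<Rightarrow> nat \<Rightarrow> real \<Rightarrow> real^3" where
  "x_pipe n v i = (let p = vertex n v i; q = vertex n v (Suc i)
     in linepath (vector [p$1, p$2, p$3]) (vector [q$1, p$2, p$3]))"

definition y_pipe :: "nat \<Rightarrow> (nat \<Rightarrow> real^3) \<Rightarrow> nat \<Rightarrow> real \<Rightarrow> real^3" where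
  "y_pipe n v i = (let p = vertex n v i; q = vertex n v (Suc i)
     in linepath (vector [q$1, p$2, p$3]) (vector [q$1, q$2, p$3]))"

definition z_pipe :: "nat \<Rightarrow> (nat \<Rightarrow> real^3) \<Rightarrow> nat \<Rightarrow> real \<Rightarrow> real^3" where
  "z_pipe n v i = (let p = vertex n v i; q = vertex n v (Suc i)
     in linepath (vector [q$1, q$2, p$3]) (vector [q$1, q$2, q$3]))"

text \<open>
  The \<open>k\<close>-th pipe, for \<open>k < 3 * n\<close>, in the order \<open>x\<^sub>0, y\<^sub>0, z\<^sub>0, x\<^sub>1, \<dots>, z\<^bsub>n-1\<^esub>\<close>.
\<close>

definition pipe :: "nat \<Rightarrow> (nat \<Rightarrow> real^3) \<Rightarrow> nat \<Rightarrow> real \<Rightarrow> real^3" where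
  "pipe n v k = (if k mod 3 = 0 then x_pipe n v (k div 3)
                 else if k mod 3 = 1 then y_pipe n v (k div 3)
                 else z_pipe n v (k div 3))"

text \<open>
  The curve is parametrized by \<open>{0..1}\<close> and traverses the \<open>k\<close>-th pipe linearly on
  \<open>{k/(3*n)..(k+1)/(3*n)}\<close>; the minimum only serves to include the endpoint \<open>t = 1\<close>.
\<close>

definition plumbers_curve :: "nat \<Rightarrow> (nat \<Rightarrow> real^3) \<Rightarrow> real \<Rightarrow> real^3" where
  "plumbers_curve n v = (\<lambda>t\<in>{0..1}.
     let s = real (3 * n) * t; k = min (nat \<lfloor>s\<rfloor>) (3 * n - 1)
     in pipe n v k (s - real k))"

text \<open>
  The space of plumbers' curves carries the topology of the parameter space, transported along
  the bijection \<open>plumbers_curve n\<close>; it is injective because \<open>v\<close> can be read off from the curve,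
  see \<open>inj_on_plumbers_curve\<close> below.
\<close>

definition plumbers_curves :: "nat \<Rightarrow> (real \<Rightarrow> real^3) set" where
  "plumbers_curves n = plumbers_curve n ` parameters n"

definition plumbers_curve_topology :: "nat \<Rightarrow> (real \<Rightarrow> real^3) topology" where
  "plumbers_curve_topology n =
     pullback_topology (plumbers_curves n) (inv_into (parameters n) (plumbers_curve n))
       (parameter_topology n)"

lemma plumbers_curve_vertex:
  assumes "i < n"
  shows "plumbers_curve n v (real i / real n) = vertex n v i"
proof -
  have "real (3 * n) * (real i / real n) = real (3 * i)"
    using assms by simp
  moreover have "min (3 * i) (3 * n - 1) = 3 * i" "real i / real n \<in> {0..1}"
    using assms by auto
  moreover have "nat \<lfloor>real (3 * i)\<rfloor> = 3 * i"
    by linarith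
  ultimately have "plumbers_curve n v (real i / real n) = pipe n v (3 * i) 0"
    by (simp only: plumbers_curve_def restrict_apply Let_def if_True diff_self)
  also have "\<dots> = vertex n v i"
    by (simp add: pipe_def x_pipe_def Let_def linepath_def vec_eq_iff forall_3 vector_3)
  finally show ?thesis .
qed

lemma inj_on_plumbers_curve: "inj_on (plumbers_curve n) (parameters n)"
proof (rule inj_onI)
  fix v w
  assume v: "v \<in> parameters n" and w: "w \<in> parameters n"
    and eq: "plumbers_curve n v = plumbers_curve n w"
  show "v = w"
  proof (rule PiE_ext)
    show "v \<in> {1..n-1} \<rightarrow>\<^sub>E box 0 1" "w \<in> {1..n-1} \<rightarrow>\<^sub>E box 0 1"
      using v w by (simp_all add: parameters_def)
    show "v i = w i" if "i \<in> {1..n-1}" for i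
    proof -
      have "i < n" "i \<noteq> 0" using that by auto
      then show ?thesis
        using plumbers_curve_vertex[of i n v] plumbers_curve_vertex[of i n w] eq
        by (simp add: vertex_def)
    qed
  qed
qed

definition distant :: "nat \<Rightarrow> nat \<Rightarrow> bool" where
  "distant j k \<longleftrightarrow> card {min j k<..<max j k} \<ge> 3"

definition singular :: "nat \<Rightarrow> (nat \<Rightarrow> real^3) \<Rightarrow> bool" where
  "singular n v \<longleftrightarrow> (\<exists>j<3*n. \<exists>k<3*n. distant j k \<and>
     path_image (pipe n v j) \<inter> path_image (pipe n v k) \<noteq> {})"

definition plumbers_knots :: "nat \<Rightarrow> (real \<Rightarrow> real^3) set" where
  "plumbers_knots n = plumbers_curve n ` {v \<in> parameters n. \<not> singular n v}"

definition geometric_isotopy ::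
  "nat \<Rightarrow> (real \<Rightarrow> real \<Rightarrow> real^3) \<Rightarrow> (real \<Rightarrow> real^3) \<Rightarrow> (real \<Rightarrow> real^3) \<Rightarrow> bool" where
  "geometric_isotopy n h f g \<longleftrightarrow>
     pathin (subtopology (plumbers_curve_topology n) (plumbers_knots n)) h \<and> h 0 = f \<and> h 1 = g"

definition interpolate ::
  "nat \<Rightarrow> (nat \<Rightarrow> real^3) \<Rightarrow> (nat \<Rightarrow> real^3) \<Rightarrow> real \<Rightarrow> nat \<Rightarrow> real^3" where
  "interpolate n v w t = (\<lambda>i\<in>{1..n-1}. (1 - t) *\<^sub>R v i + t *\<^sub>R w i)"

definition straight_line_geometric_isotopy ::
  "nat \<Rightarrow> (real \<Rightarrow> real \<Rightarrow> real^3) \<Rightarrow> (real \<Rightarrow> real^3) \<Rightarrow> (real \<Rightarrow> real^3) \<Rightarrow> bool" where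
  "straight_line_geometric_isotopy n h f g \<longleftrightarrow> geometric_isotopy n h f g \<and>
     (\<exists>v\<in>parameters n. \<exists>w\<in>parameters n. f = plumbers_curve n v \<and> g = plumbers_curve n w \<and>
        (\<forall>t\<in>{0..1}. h t = plumbers_curve n (interpolate n v w t)))"

section \<open>Cells\<close>

text \<open>
  Elements of the symmetric group on \<open>{1..n-1}\<close> are functions \<open>\<sigma>\<close> with \<open>\<sigma> permutes {1..n-1}\<close>.
  These fix all numbers outside \<open>{1..n-1}\<close>, so the conventions \<open>\<sigma>\<^sup>-\<^sup>1(0) = 0\<close> and \<open>\<sigma>\<^sup>-\<^sup>1(n) = n\<close> hold
  automatically for \<open>inv \<sigma>\<close>. The triple of permutations serves as the name of a cell.
\<close>

definition cell :: "nat \<Rightarrow> (nat \<Rightarrow> nat) \<Rightarrow> (nat \<Rightarrow> nat) \<Rightarrow> (nat \<Rightarrow> nat) \<Rightarrow> (real \<Rightarrow> real^3) set" where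
  "cell n \<sigma>x \<sigma>y \<sigma>z = plumbers_curve n ` {v \<in> parameters n.
     strict_mono_on {1..n-1} (\<lambda>i. v (\<sigma>x i) $ 1) \<and>
     strict_mono_on {1..n-1} (\<lambda>i. v (\<sigma>y i) $ 2) \<and>
     strict_mono_on {1..n-1} (\<lambda>i. v (\<sigma>z i) $ 3)}"

definition representative_parameter ::
  "nat \<Rightarrow> (nat \<Rightarrow> nat) \<Rightarrow> (nat \<Rightarrow> nat) \<Rightarrow> (nat \<Rightarrow> nat) \<Rightarrow> nat \<Rightarrow> real^3" where
  "representative_parameter n \<sigma>x \<sigma>y \<sigma>z = (\<lambda>i\<in>{1..n-1}.
     vector [real (inv \<sigma>x i) / real n, real (inv \<sigma>y i) / real n, real (inv \<sigma>z i) / real n])"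

definition representative_knot ::
  "nat \<Rightarrow> (nat \<Rightarrow> nat) \<Rightarrow> (nat \<Rightarrow> nat) \<Rightarrow> (nat \<Rightarrow> nat) \<Rightarrow> real \<Rightarrow> real^3" where
  "representative_knot n \<sigma>x \<sigma>y \<sigma>z = plumbers_curve n (representative_parameter n \<sigma>x \<sigma>y \<sigma>z)"

lemma representative_parameter_in_parameters:
  assumes "\<sigma>x permutes {1..n-1}" "\<sigma>y permutes {1..n-1}" "\<sigma>z permutes {1..n-1}"
  shows "representative_parameter n \<sigma>x \<sigma>y \<sigma>z \<in> parameters n"
proof -
  have *: "0 < inv \<sigma> i \<and> inv \<sigma> i < n" if "\<sigma> permutes {1..n-1}" "i \<in> {1..n-1}" for \<sigma> :: "nat \<Rightarrow> nat" and i
  proof -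
    have "inv \<sigma> i \<in> {1..n-1}"
      using permutes_in_image[OF permutes_inv[OF that(1)], of i] that(2) by simp
    with that(2) show ?thesis by auto
  qed
  show ?thesis
    using *[OF assms(1)] *[OF assms(2)] *[OF assms(3)]
    by (auto simp: parameters_def representative_parameter_def mem_box_cart forall_3 vector_3)
qed

lemma representative_knot_in_cell:
  assumes "\<sigma>x permutes {1..n-1}" "\<sigma>y permutes {1..n-1}" "\<sigma>z permutes {1..n-1}"
  shows "representative_knot n \<sigma>x \<sigma>y \<sigma>z \<in> cell n \<sigma>x \<sigma>y \<sigma>z"
proof -
  let ?v = "representative_parameter n \<sigma>x \<sigma>y \<sigma>z"
  have coord: "?v (\<sigma>x i) $ 1 = real i / real n" "?v (\<sigma>y i) $ 2 = real i / real n"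
    "?v (\<sigma>z i) $ 3 = real i / real n" if "i \<in> {1..n-1}" for i
    using that assms[THEN permutes_in_image, of i] assms[THEN permutes_inverses(2), of i]
    by (simp_all add: representative_parameter_def vector_3)
  have "strict_mono_on {1..n-1} (\<lambda>i. ?v (\<sigma>x i) $ 1)"
    "strict_mono_on {1..n-1} (\<lambda>i. ?v (\<sigma>y i) $ 2)"
    "strict_mono_on {1..n-1} (\<lambda>i. ?v (\<sigma>z i) $ 3)"
    by (rule strict_mono_onI, simp only: coord, simp add: divide_strict_right_mono)+
  then show ?thesis
    unfolding representative_knot_def cell_def
    using representative_parameter_in_parameters[OF assms] by blast
qed

definition transposition_appears :: "nat \<Rightarrow> (nat \<Rightarrow> nat) \<Rightarrow> (nat \<Rightarrow> nat) \<Rightarrow> bool" where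
  "transposition_appears n \<tau> \<sigma> \<longleftrightarrow>
     (\<exists>i\<in>{1..n-2}. \<tau> = Transposition.transpose (\<sigma> i) (\<sigma> (i + 1)))"

definition strictly_between :: "nat \<Rightarrow> nat \<Rightarrow> nat \<Rightarrow> bool" where
  "strictly_between p q r \<longleftrightarrow> q < p \<and> p < r \<or> r < p \<and> p < q"

definition produces_yz_intersection ::
  "(nat \<Rightarrow> nat) \<Rightarrow> (nat \<Rightarrow> nat) \<Rightarrow> nat \<Rightarrow> nat \<Rightarrow> bool" where
  "produces_yz_intersection \<sigma>y \<sigma>z a b \<longleftrightarrow>
     strictly_between (inv \<sigma>y b) (inv \<sigma>y (a - 1)) (inv \<sigma>y a) \<and>
     strictly_between (inv \<sigma>z (a - 1)) (inv \<sigma>z (b - 1)) (inv \<sigma>z b)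
   \<or> strictly_between (inv \<sigma>y a) (inv \<sigma>y (b - 1)) (inv \<sigma>y b) \<and>
     strictly_between (inv \<sigma>z (b - 1)) (inv \<sigma>z (a - 1)) (inv \<sigma>z a)"

end

theory Submission
  imports Defs
begin

text \<open>
  A plumbers' curve determines its parameter, so the only candidate for a straight-line isotopy is
  the segment between the two representative parameters, and it is an isotopy exactly when none
  of its points is singular (\<open>straight_line_geometric_isotopy_iff\<close>). Along this segment the
  \<open>y\<close>- and \<open>z\<close>-coordinates of the vertices stay fixed, and they are pairwise distinct. Two pipes can
  then meet without being neighbours only if one is a \<open>y\<close>-pipe, the other a \<open>z\<close>-pipe, and both lie
  in the same plane \<open>x = const\<close>, that is, if two different vertices have the same
  \<open>x\<close>-coordinate; whether they do meet is decided by the order of the \<open>y\<close>- and of the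
  \<open>z\<close>-coordinates (\<open>singular_iff_yz_crossing\<close>).

  The transposition exchanges the \<open>x\<close>-coordinates of the vertices \<open>a\<close> and \<open>b\<close>, which are neighbours
  in the \<open>x\<close>-order. So these two move through a gap that contains no other vertex, and the only
  coincidence of \<open>x\<close>-coordinates is that of \<open>a\<close> and \<open>b\<close> at time \<open>1/2\<close>
  (\<open>swap_neighbours_coincide_iff\<close>). At that moment the curve is singular iff the \<open>y\<close>-pipe at one of
  the two vertices crosses the \<open>z\<close>-pipe at the other. The two choices are the two clauses in the
  definition of producing a \<open>y\<close>-\<open>z\<close> intersection.
\<close>

section \<open>Singularities of curves in general position\<close>

lemma closed_segment_vector_3_iff:
  fixes q :: "real^3"
  shows "q \<in> closed_segment (vector [a, b, c]) (vector [a', b, c]) \<longleftrightarrow>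
      q$1 \<in> closed_segment a a' \<and> q$2 = b \<and> q$3 = c"
    and "q \<in> closed_segment (vector [a, b, c]) (vector [a, b', c]) \<longleftrightarrow>
      q$1 = a \<and> q$2 \<in> closed_segment b b' \<and> q$3 = c"
    and "q \<in> closed_segment (vector [a, b, c]) (vector [a, b, c']) \<longleftrightarrow>
      q$1 = a \<and> q$2 = b \<and> q$3 \<in> closed_segment c c'"
  by (auto simp: closed_segment_def vec_eq_iff forall_3 vector_3 algebra_simps)

lemma distant_iff: "distant j k \<longleftrightarrow> j + 4 \<le> k \<or> k + 4 \<le> j"
  by (auto simp: distant_def min_def max_def)

lemma path_image_pipe:
  fixes q :: "real^3"
  shows "q \<in> path_image (pipe n v (3 * i)) \<longleftrightarrow>
      q$1 \<in> closed_segment (vertex n v i $ 1) (vertex n v (Suc i) $ 1) \<and>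
      q$2 = vertex n v i $ 2 \<and> q$3 = vertex n v i $ 3"
    and "q \<in> path_image (pipe n v (3 * i + 1)) \<longleftrightarrow>
      q$1 = vertex n v (Suc i) $ 1 \<and>
      q$2 \<in> closed_segment (vertex n v i $ 2) (vertex n v (Suc i) $ 2) \<and>
      q$3 = vertex n v i $ 3"
    and "q \<in> path_image (pipe n v (3 * i + 2)) \<longleftrightarrow>
      q$1 = vertex n v (Suc i) $ 1 \<and> q$2 = vertex n v (Suc i) $ 2 \<and>
      q$3 \<in> closed_segment (vertex n v i $ 3) (vertex n v (Suc i) $ 3)"
proof -
  have "(3 * i + 1) div 3 = i" "(3 * i + 2) div 3 = i" "(3 * i + 1) mod 3 = 1" "(3 * i + 2) mod 3 = 2"
    by presburger+
  then show "q \<in> path_image (pipe n v (3 * i)) \<longleftrightarrow>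
      q$1 \<in> closed_segment (vertex n v i $ 1) (vertex n v (Suc i) $ 1) \<and>
      q$2 = vertex n v i $ 2 \<and> q$3 = vertex n v i $ 3"
    and "q \<in> path_image (pipe n v (3 * i + 1)) \<longleftrightarrow>
      q$1 = vertex n v (Suc i) $ 1 \<and>
      q$2 \<in> closed_segment (vertex n v i $ 2) (vertex n v (Suc i) $ 2) \<and>
      q$3 = vertex n v i $ 3"
    and "q \<in> path_image (pipe n v (3 * i + 2)) \<longleftrightarrow>
      q$1 = vertex n v (Suc i) $ 1 \<and> q$2 = vertex n v (Suc i) $ 2 \<and>
      q$3 \<in> closed_segment (vertex n v i $ 3) (vertex n v (Suc i) $ 3)"
    by (simp_all only: pipe_def x_pipe_def y_pipe_def z_pipe_def Let_def path_image_linepath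
        closed_segment_vector_3_iff) (simp_all add: closed_segment_vector_3_iff)
qed

lemma pipe_cases:
  fixes j n :: nat
  assumes "j < 3 * n"
  obtains i where "i < n" "j = 3 * i" | i where "i < n" "j = 3 * i + 1"
    | i where "i < n" "j = 3 * i + 2"
proof -
  have "j div 3 < n" "j = 3 * (j div 3) \<or> j = 3 * (j div 3) + 1 \<or> j = 3 * (j div 3) + 2"
    using assms by presburger+
  then show thesis using that by blast
qed

text \<open>
  Two pipes that meet and are not a \<open>y\<close>-pipe and a \<open>z\<close>-pipe are both at a fixed \<open>y\<close>-level or both
  at a fixed \<open>z\<close>-level. The levels agree, and by injectivity this makes the pipes equal or
  consecutive. There remain the \<open>y\<close>-pipe in which \<open>y\<close> moves from its value at vertex \<open>k - 1\<close> to
  that at vertex \<open>k\<close>, and the \<open>z\<close>-pipe in which \<open>z\<close> moves from its value at vertex \<open>l - 1\<close> to that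
  at vertex \<open>l\<close>; they lie in the planes of the \<open>x\<close>-coordinates of \<open>k\<close> and \<open>l\<close>. If these
  planes agree, the pipes meet iff two coordinates lie in closed segments. By injectivity an
  endpoint can be attained only for \<open>l = k\<close> or \<open>l = k - 1\<close>, which are precisely the cases in which
  the two pipes are not distant. Hence passing to open segments encodes
  distance.
\<close>

lemma singular_iff_yz_crossing:
  assumes y: "inj_on (\<lambda>i. vertex n v i $ 2) {0..n}"
    and z: "inj_on (\<lambda>i. vertex n v i $ 3) {0..n}"
  shows "singular n v \<longleftrightarrow> (\<exists>k\<in>{1..n}. \<exists>l\<in>{1..n}.
      vertex n v k $ 1 = vertex n v l $ 1 \<and>
      vertex n v l $ 2 \<in> open_segment (vertex n v (k - 1) $ 2) (vertex n v k $ 2) \<and>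
      vertex n v (k - 1) $ 3 \<in> open_segment (vertex n v (l - 1) $ 3) (vertex n v l $ 3))"
    (is "_ \<longleftrightarrow> (\<exists>k\<in>_. \<exists>l\<in>_. ?cross k l)")
proof
  have y': "vertex n v i $ 2 = vertex n v j $ 2 \<longleftrightarrow> i = j"
    and z': "vertex n v i $ 3 = vertex n v j $ 3 \<longleftrightarrow> i = j" if "i \<le> n" "j \<le> n" for i j
    using that inj_on_eq_iff[OF y] inj_on_eq_iff[OF z] by auto
  have yz: "\<exists>k\<in>{1..n}. \<exists>l\<in>{1..n}. ?cross k l"
    if "i < n" "j < n" "distant (3 * i + 1) (3 * j + 2)"
      "q \<in> path_image (pipe n v (3 * i + 1))" "q \<in> path_image (pipe n v (3 * j + 2))" for i j q
  proof -
    have ij: "i \<noteq> j" "i \<noteq> Suc j"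
      using that(3) by (auto simp: distant_iff)
    have "?cross (Suc i) (Suc j)"
      using that ij unfolding path_image_pipe
      by (simp add: open_segment_def y' z')
    then show ?thesis using that(1,2) by (intro bexI[of _ "Suc i"] bexI[of _ "Suc j"]) auto
  qed
  assume "singular n v"
  then obtain j k q where jk: "j < 3 * n" "k < 3 * n" "distant j k"
    and q: "q \<in> path_image (pipe n v j)" "q \<in> path_image (pipe n v k)"
    unfolding singular_def by blast
  have kj: "distant k j" using jk(3) by (auto simp: distant_iff)
  from jk(1) show "\<exists>k\<in>{1..n}. \<exists>l\<in>{1..n}. ?cross k l"
  proof (cases rule: pipe_cases)
    case 1
    note i = this
    from jk(2) show ?thesis
      by (cases rule: pipe_cases)
        (use i jk(3) q in \<open>(simp only: path_image_pipe distant_iff; auto simp: y' z')+\<close>)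
  next
    case 2
    note i = this
    from jk(2) show ?thesis
    proof (cases rule: pipe_cases)
      case (3 l)
      then show ?thesis using yz i jk q by blast
    qed (use i jk(3) q in \<open>(simp only: path_image_pipe distant_iff; auto simp: y' z')+\<close>)
  next
    case 3
    note i = this
    from jk(2) show ?thesis
    proof (cases rule: pipe_cases)
      case (2 l)
      then show ?thesis using yz i kj q by blast
    qed (use i jk(3) q in \<open>(simp only: path_image_pipe distant_iff; auto simp: y' z')+\<close>)
  qed
next
  assume "\<exists>k\<in>{1..n}. \<exists>l\<in>{1..n}. ?cross k l"
  then obtain k l where kl: "k \<in> {1..n}" "l \<in> {1..n}" and cross: "?cross k l"
    by blast
  have "k \<noteq> l" "l \<noteq> k - 1"
    using cross by (auto simp: open_segment_def)
  define i where "i = k - 1"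
  define j where "j = l - 1"
  have ij: "k = Suc i" "l = Suc j" "i < n" "j < n"
    using kl by (auto simp: i_def j_def)
  have d: "distant (3 * i + 1) (3 * j + 2)"
    using \<open>k \<noteq> l\<close> \<open>l \<noteq> k - 1\<close> unfolding distant_iff ij by simp presburger
  \<comment> \<open>The only point that the plane and the two fixed levels allow.\<close>
  define q :: "real^3" where
    "q = vector [vertex n v k $ 1, vertex n v l $ 2, vertex n v (k - 1) $ 3]"
  have "q \<in> path_image (pipe n v (3 * i + 1))" "q \<in> path_image (pipe n v (3 * j + 2))"
    using cross unfolding path_image_pipe q_def
    by (auto simp: vector_3 open_segment_def ij)
  then show "singular n v"
    unfolding singular_def using d ij
    by (intro exI[of _ "3 * i + 1"] conjI exI[of _ "3 * j + 2"]) auto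
qed

section \<open>Straight-line isotopies\<close>

lemma interpolate_in_parameters:
  assumes "v \<in> parameters n" "w \<in> parameters n" "t \<in> {0..1}"
  shows "interpolate n v w t \<in> parameters n"
proof -
  have "(1 - t) *\<^sub>R v i + t *\<^sub>R w i \<in> box 0 1" if "i \<in> {1..n-1}" for i
    using assms that convexD[OF convex_box(2), of "v i" 0 1 "w i" "1 - t" t]
    by (auto simp: parameters_def PiE_iff)
  then show ?thesis by (auto simp: parameters_def interpolate_def)
qed

lemma plumbers_curve_in_plumbers_knots_iff:
  assumes "v \<in> parameters n"
  shows "plumbers_curve n v \<in> plumbers_knots n \<longleftrightarrow> \<not> singular n v"
  using assms inj_onD[OF inj_on_plumbers_curve[of n]] by (auto simp: plumbers_knots_def)

text \<open>
  The topology on curves is pulled back along the inverse of \<open>plumbers_curve n\<close>, so continuity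
  of \<open>plumbers_curve n\<close> amounts to that of the identity on parameters.
\<close>

lemma continuous_map_plumbers_curve:
  "continuous_map (parameter_topology n) (plumbers_curve_topology n) (plumbers_curve n)"
proof -
  have sp: "topspace (parameter_topology n) = parameters n"
    by (simp add: parameter_topology_def parameters_def)
  have "continuous_map (parameter_topology n) (parameter_topology n)
      (inv_into (parameters n) (plumbers_curve n) \<circ> plumbers_curve n)"
    by (rule continuous_map_eq[OF continuous_map_id])
      (simp add: sp inj_on_plumbers_curve)
  then show ?thesis
    unfolding plumbers_curve_topology_def
    by (rule continuous_map_pullback') (auto simp: sp plumbers_curves_def)
qed

lemma continuous_map_interpolate:
  assumes "v \<in> parameters n" "w \<in> parameters n"
  shows "continuous_map (top_of_set {0..1}) (parameter_topology n) (interpolate n v w)"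
proof -
  have "(\<lambda>t. interpolate n v w t i) \<in> {0..1} \<rightarrow> box 0 1" if "i \<in> {1..n-1}" for i
    using interpolate_in_parameters[OF assms] that by (auto simp: parameters_def PiE_iff)
  moreover have "continuous_on {0..1} (\<lambda>t. interpolate n v w t i)" if "i \<in> {1..n-1}" for i
    using that by (simp add: interpolate_def) (intro continuous_intros)
  ultimately show ?thesis
    unfolding parameter_topology_def continuous_map_componentwise
    by (auto simp: interpolate_def)
qed

text \<open>
  Injectivity of \<open>plumbers_curve n\<close> leaves no choice for the parameters of the end curves, nor for
  the parameter of a curve on the path: it is a knot iff that very parameter is nonsingular.
\<close>

lemma straight_line_geometric_isotopy_iff:
  assumes v: "v \<in> parameters n" and w: "w \<in> parameters n"
  shows "(\<exists>h. straight_line_geometric_isotopy n h (plumbers_curve n v) (plumbers_curve n w))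
    \<longleftrightarrow> (\<forall>t\<in>{0..1}. \<not> singular n (interpolate n v w t))" (is "?L \<longleftrightarrow> ?R")
proof
  assume ?L
  then obtain h v' w' where p: "pathin (subtopology (plumbers_curve_topology n) (plumbers_knots n)) h"
    and v': "v' \<in> parameters n" "plumbers_curve n v = plumbers_curve n v'"
    and w': "w' \<in> parameters n" "plumbers_curve n w = plumbers_curve n w'"
    and h: "\<And>t. t \<in> {0..1} \<Longrightarrow> h t = plumbers_curve n (interpolate n v' w' t)"
    by (auto simp: straight_line_geometric_isotopy_def geometric_isotopy_def)
  have "v' = v" "w' = w"
    using inj_on_eq_iff[OF inj_on_plumbers_curve] v w v' w' by simp_all
  moreover have "h t \<in> plumbers_knots n" if "t \<in> {0..1}" for t
    using p that by (simp add: pathin_subtopology)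
  ultimately show ?R
    using h plumbers_curve_in_plumbers_knots_iff[OF interpolate_in_parameters[OF v w]] by simp
next
  assume R: ?R
  define h where "h = plumbers_curve n \<circ> interpolate n v w"
  have "continuous_map (top_of_set {0..1}) (plumbers_curve_topology n) h"
    unfolding h_def
    by (rule continuous_map_compose[OF continuous_map_interpolate[OF v w] continuous_map_plumbers_curve])
  moreover have "h t \<in> plumbers_knots n" if "t \<in> {0..1}" for t
    using R that plumbers_curve_in_plumbers_knots_iff[OF interpolate_in_parameters[OF v w that]]
    by (simp add: h_def)
  ultimately have "pathin (subtopology (plumbers_curve_topology n) (plumbers_knots n)) h"
    unfolding pathin_subtopology by (simp add: pathin_def)
  moreover have "interpolate n v w 0 = v" "interpolate n v w 1 = w"
    using v w by (simp_all add: interpolate_def parameters_def PiE_restrict)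
  ultimately have "geometric_isotopy n h (plumbers_curve n v) (plumbers_curve n w)"
    by (simp add: geometric_isotopy_def h_def)
  then have "straight_line_geometric_isotopy n h (plumbers_curve n v) (plumbers_curve n w)"
    unfolding straight_line_geometric_isotopy_def
    by (intro conjI bexI[OF _ v] bexI[OF _ w]) (simp_all add: h_def)
  then show ?L by blast
qed

section \<open>Moving two neighbouring coordinates past each other\<close>

lemma permutes_inv_endpoints:
  assumes "\<sigma> permutes {1..n-1::nat}" "n > 0"
  shows "inv \<sigma> 0 = 0" "inv \<sigma> n = n"
  using permutes_not_in[OF permutes_inv[OF assms(1)]] assms(2) by auto

text \<open>
  As the inverse permutations fix \<open>0\<close> and \<open>n\<close>, the formula also covers the conventional end vertices
  \<open>(0,0,0)\<close> and \<open>(1,1,1)\<close>.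
\<close>

lemma vertex_interpolate_representative_parameter:
  assumes "n > 0" "k \<le> n"
    and "\<sigma>x permutes {1..n-1}" "\<sigma>y permutes {1..n-1}" "\<sigma>z permutes {1..n-1}"
    and "\<rho>x permutes {1..n-1}"
  shows "vertex n (interpolate n (representative_parameter n \<sigma>x \<sigma>y \<sigma>z)
      (representative_parameter n \<rho>x \<sigma>y \<sigma>z) t) k =
    vector [((1 - t) * real (inv \<sigma>x k) + t * real (inv \<rho>x k)) / real n,
      real (inv \<sigma>y k) / real n, real (inv \<sigma>z k) / real n]"
proof (cases "k = 0 \<or> k = n")
  case True
  then show ?thesis
    using assms by (auto simp: vertex_def permutes_inv_endpoints vec_eq_iff forall_3 vector_3 field_simps)
next
  case False
  then show ?thesis
    using assms by (auto simp: vertex_def interpolate_def representative_parameter_def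
        vec_eq_iff forall_3 vector_3 field_simps)
qed

text \<open>
  The two moving points stay between the consecutive integers \<open>p a\<close> and \<open>p b\<close>, all the others rest
  at integers outside this interval; so only the moving points can coincide, and by symmetry they
  do so half-way.
\<close>

lemma swap_neighbours_coincide_iff:
  fixes p :: "nat \<Rightarrow> nat" and t :: real
  assumes "inj p" and ab: "p a = Suc (p b) \<or> p b = Suc (p a)" and t: "t \<in> {0..1}" and "k \<noteq> l"
  shows "(1 - t) * real (p k) + t * real (p (Transposition.transpose a b k)) =
      (1 - t) * real (p l) + t * real (p (Transposition.transpose a b l)) \<longleftrightarrow>
    t = 1/2 \<and> (k = a \<and> l = b \<or> k = b \<and> l = a)"
proof -
  define m where "m = min (p a) (p b)"
  have m: "p a = m \<and> p b = Suc m \<or> p b = m \<and> p a = Suc m"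
    using ab by (auto simp: m_def)
  let ?f = "\<lambda>k. (1 - t) * real (p k) + t * real (p (Transposition.transpose a b k))"
  have moving: "real m \<le> ?f k \<and> ?f k \<le> real m + 1" if "k = a \<or> k = b" for k
    using m t that by (auto simp: algebra_simps)
  have fixed: "?f k = real (p k) \<and> (real (p k) < real m \<or> real (p k) > real m + 1)"
    if "k \<noteq> a" "k \<noteq> b" for k
  proof -
    have "p k \<noteq> p a" "p k \<noteq> p b" using that injD[OF \<open>inj p\<close>] by metis+
    then have "p k < m \<or> p k > m + 1" using m by auto
    then show ?thesis using that by (auto simp: algebra_simps)
  qed
  have "p k \<noteq> p l" using \<open>k \<noteq> l\<close> injD[OF \<open>inj p\<close>] by metis
  consider "k = a \<and> l = b \<or> k = b \<and> l = a" | "k = a \<or> k = b" "l \<noteq> a" "l \<noteq> b"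
    | "k \<noteq> a" "k \<noteq> b" "l = a \<or> l = b" | "k \<noteq> a" "k \<noteq> b" "l \<noteq> a" "l \<noteq> b"
    using \<open>k \<noteq> l\<close> by blast
  then show ?thesis
  proof cases
    case 1
    then show ?thesis using m by (auto simp: algebra_simps)
  next
    case 2
    then show ?thesis using moving[of k] fixed[of l] by auto
  next
    case 3
    then show ?thesis using moving[of l] fixed[of k] by auto
  next
    case 4
    then show ?thesis using fixed[of k] fixed[of l] \<open>p k \<noteq> p l\<close> by auto
  qed
qed

lemma strictly_between_iff_open_segment:
  assumes "n > 0"
  shows "real p / real n \<in> open_segment (real q / real n) (real r / real n) \<longleftrightarrow> strictly_between p q r"
  using assms by (auto simp: open_segment_eq_real_ivl strictly_between_def divide_less_cancel divide_le_cancel)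

lemma transposition_appearsE:
  assumes "\<sigma> permutes {1..n-1}" "transposition_appears n (Transposition.transpose a b) \<sigma>"
  shows "a \<in> {1..n-1}" "b \<in> {1..n-1}" "inv \<sigma> a = Suc (inv \<sigma> b) \<or> inv \<sigma> b = Suc (inv \<sigma> a)"
proof -
  obtain i where i: "i \<in> {1..n-2}"
    and eq: "Transposition.transpose a b = Transposition.transpose (\<sigma> i) (\<sigma> (Suc i))"
    using assms(2) unfolding transposition_appears_def Suc_eq_plus1 by blast
  have inj: "inj \<sigma>" by (rule permutes_inj[OF assms(1)])
  have "\<sigma> i \<noteq> \<sigma> (Suc i)" by (simp add: inj_eq[OF inj])
  moreover have "Transposition.transpose a b (\<sigma> i) = \<sigma> (Suc i)"
    by (simp add: eq)
  ultimately have ab: "a = \<sigma> i \<and> b = \<sigma> (Suc i) \<or> a = \<sigma> (Suc i) \<and> b = \<sigma> i"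
    by (auto simp: Transposition.transpose_def split: if_splits)
  have "\<sigma> i \<in> {1..n-1}" "\<sigma> (Suc i) \<in> {1..n-1}"
    using i by (simp_all only: permutes_in_image[OF assms(1)]) auto
  then show "a \<in> {1..n-1}" "b \<in> {1..n-1}" using ab by auto
  show "inv \<sigma> a = Suc (inv \<sigma> b) \<or> inv \<sigma> b = Suc (inv \<sigma> a)"
    using ab by (auto simp: inv_f_f[OF inj])
qed

text \<open>
  The interpolated curve is singular at no time other than \<open>1/2\<close>, and there only if the crossing
  condition holds for \<open>(k, l) = (a, b)\<close> or \<open>(k, l) = (b, a)\<close>.
\<close>

theorem theorem2p15:
  fixes n a b :: nat and \<sigma>x \<sigma>y \<sigma>z :: "nat \<Rightarrow> nat"
  assumes "n \<ge> 3"
    and "\<sigma>x permutes {1..n-1}" and "\<sigma>y permutes {1..n-1}" and "\<sigma>z permutes {1..n-1}"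
    and "transposition_appears n (Transposition.transpose a b) \<sigma>x"
  shows "(\<exists>h. straight_line_geometric_isotopy n h
            (representative_knot n \<sigma>x \<sigma>y \<sigma>z)
            (representative_knot n (Transposition.transpose a b \<circ> \<sigma>x) \<sigma>y \<sigma>z))
         \<longleftrightarrow> \<not> produces_yz_intersection \<sigma>y \<sigma>z a b"
proof -
  let ?\<tau> = "Transposition.transpose a b"
  let ?v = "representative_parameter n \<sigma>x \<sigma>y \<sigma>z"
  let ?w = "representative_parameter n (?\<tau> \<circ> \<sigma>x) \<sigma>y \<sigma>z"
  note ab = transposition_appearsE[OF assms(2,5)]
  have n: "n > 0" using \<open>n \<ge> 3\<close> by simp
  have \<tau>\<sigma>: "?\<tau> \<circ> \<sigma>x permutes {1..n-1}"
    using permutes_compose[OF assms(2) permutes_swap_id[OF ab(1,2)]] .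
  have inv_\<tau>\<sigma>: "inv (?\<tau> \<circ> \<sigma>x) k = inv \<sigma>x (?\<tau> k)" for k
    by (simp only: o_inv_distrib[OF bij_transpose permutes_bij[OF assms(2)]] inv_transpose_eq o_apply)
  have sing: "singular n (interpolate n ?v ?w t) \<longleftrightarrow> t = 1/2 \<and> produces_yz_intersection \<sigma>y \<sigma>z a b"
    if t: "t \<in> {0..1}" for t
  proof -
    let ?u = "interpolate n ?v ?w t"
    have coord: "vertex n ?u k $ 1 =
        ((1 - t) * real (inv \<sigma>x k) + t * real (inv \<sigma>x (?\<tau> k))) / real n"
      "vertex n ?u k $ 2 = real (inv \<sigma>y k) / real n"
      "vertex n ?u k $ 3 = real (inv \<sigma>z k) / real n" if "k \<le> n" for k
      using vertex_interpolate_representative_parameter[OF n that assms(2-4) \<tau>\<sigma>, of t]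
      by (simp_all add: vector_3 inv_\<tau>\<sigma>)
    have x: "vertex n ?u k $ 1 = vertex n ?u l $ 1 \<longleftrightarrow>
        t = 1/2 \<and> (k = a \<and> l = b \<or> k = b \<and> l = a)" if "k \<le> n" "l \<le> n" "k \<noteq> l" for k l
      using swap_neighbours_coincide_iff[OF permutes_inj[OF permutes_inv[OF assms(2)]] ab(3) t that(3)]
        that n by (simp add: coord)
    have inj: "inj_on (\<lambda>k. vertex n ?u k $ 2) {0..n}" "inj_on (\<lambda>k. vertex n ?u k $ 3) {0..n}"
      using n inj_eq[OF permutes_inj[OF permutes_inv[OF assms(3)]]]
        inj_eq[OF permutes_inj[OF permutes_inv[OF assms(4)]]]
      by (simp_all add: inj_on_def coord)
    \<comment> \<open>The \<open>y\<close>-pipe at vertex \<open>k\<close> crosses the \<open>z\<close>-pipe at vertex \<open>l\<close> in the projection along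
      the \<open>x\<close>-axis.\<close>
    define C where "C k l \<longleftrightarrow> strictly_between (inv \<sigma>y l) (inv \<sigma>y (k - 1)) (inv \<sigma>y k) \<and>
        strictly_between (inv \<sigma>z (k - 1)) (inv \<sigma>z (l - 1)) (inv \<sigma>z l)" for k l
    have x_C: "vertex n ?u k $ 1 = vertex n ?u l $ 1 \<and> C k l \<longleftrightarrow>
        t = 1/2 \<and> (k = a \<and> l = b \<or> k = b \<and> l = a) \<and> C k l"
      if "k \<in> {1..n}" "l \<in> {1..n}" for k l
    proof (cases "k = l")
      case True
      then show ?thesis by (simp add: C_def strictly_between_def)
    next
      case False
      then show ?thesis using x[of k l] that by simp
    qed
    have "singular n ?u \<longleftrightarrow> (\<exists>k\<in>{1..n}. \<exists>l\<in>{1..n}. vertex n ?u k $ 1 = vertex n ?u l $ 1 \<and> C k l)"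
      unfolding singular_iff_yz_crossing[OF inj] C_def
      by (intro bex_cong refl) (simp add: coord(2,3) le_diff_conv strictly_between_iff_open_segment[OF n])
    also have "\<dots> \<longleftrightarrow> (\<exists>k\<in>{1..n}. \<exists>l\<in>{1..n}. t = 1/2 \<and> (k = a \<and> l = b \<or> k = b \<and> l = a) \<and> C k l)"
      by (intro bex_cong refl) (rule x_C)
    also have "\<dots> \<longleftrightarrow> t = 1/2 \<and> (C a b \<or> C b a)"
    proof -
      have "a \<in> {1..n}" "b \<in> {1..n}" using ab(1,2) by auto
      then show ?thesis by blast
    qed
    also have "\<dots> \<longleftrightarrow> t = 1/2 \<and> produces_yz_intersection \<sigma>y \<sigma>z a b"
      by (simp add: C_def produces_yz_intersection_def)
    finally show ?thesis .
  qed
  have "(\<exists>h. straight_line_geometric_isotopy n h (plumbers_curve n ?v) (plumbers_curve n ?w))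
      \<longleftrightarrow> (\<forall>t\<in>{0..1}. \<not> singular n (interpolate n ?v ?w t))"
    using assms \<tau>\<sigma> by (intro straight_line_geometric_isotopy_iff representative_parameter_in_parameters)
  also have "\<dots> \<longleftrightarrow> \<not> produces_yz_intersection \<sigma>y \<sigma>z a b"
    by (simp add: sing) (auto intro: bexI[of _ "1/2"])
  finally show ?thesis unfolding representative_knot_def .
qed

end
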